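(* For numbers $x,y$ set $x<y$ if and only if $x\neq y$ and $\min(x\Delta y)\in y$, where $x\Delta y=(x\setminus y)\cup(y\setminus x)$. This defines a (strict) total order on the class of all numbers. Equivalently, this order is the lexicographic order on sign-expansions, where the set of signs $\{+,-,0\}$ is ordered by $-<0<+$; that is, $x<y$ if and only if there is an ordinal $\alpha$ such that $s_x(\beta)=s_y(\beta)$ for all $\beta<\alpha$ and $s_x(\alpha)<s_y(\alpha)$.
   Context: A (Conway) number is a set $x$ of (von Neumann) ordinals having a maximal element $\mathrm{b}(x)$, its birthday. The sign-expansion of $x$ is the function $s_x$ on ordinals with $s_x(\alpha)=+$ if $\alpha<\mathrm{b}(x)$ and $\alpha\in x$; $s_x(\alpha)=-$ if $\alpha<\mathrm{b}(x)$ and $\alpha\notin x$; $s_x(\alpha)=0$ if $\alpha\ge\mathrm{b}(x)$. *)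

theory Defs
  imports Main
begin

text \<open>
  A well-ordered type \<open>'o :: wellorder\<close> plays the role of the class of ordinals, and \<open>'o set\<close>
  that of the classes of ordinals. Every class of ordinals with a maximal element \<open>b\<close> is a subset
  of the ordinal \<open>b + 1\<close>, hence a set, so numbers over the ordinals are exactly the subclasses
  having a maximal element.
\<close>

definition is_number :: "'o::wellorder set \<Rightarrow> bool" where
  "is_number x \<longleftrightarrow> (\<exists>b\<in>x. \<forall>a\<in>x. a \<le> b)"

definition numbers :: "'o::wellorder set set" where
  "numbers = {x. is_number x}"

definition birthday :: "'o::wellorder set \<Rightarrow> 'o" where
  "birthday x = (GREATEST a. a \<in> x)"

text \<open>The symmetric difference may be infinite, so its minimum is given by \<open>LEAST\<close>, not \<open>Min\<close>.\<close>

definition number_less :: "'o::wellorder set \<Rightarrow> 'o set \<Rightarrow> bool" where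
  "number_less x y \<longleftrightarrow> x \<noteq> y \<and> (LEAST a. a \<in> (x - y) \<union> (y - x)) \<in> y"

datatype sign = Minus | Zero | Plus

instantiation sign :: linorder
begin

text \<open>The order generated by \<open>Minus < Zero < Plus\<close>.\<close>

definition less_eq_sign :: "sign \<Rightarrow> sign \<Rightarrow> bool" where
  "s \<le> t \<longleftrightarrow> s = t \<or> s = Minus \<or> t = Plus"

definition less_sign :: "sign \<Rightarrow> sign \<Rightarrow> bool" where
  "s < t \<longleftrightarrow> s \<le> t \<and> s \<noteq> (t::sign)"

instance
proof
  fix s t u :: sign
  show "s < t \<longleftrightarrow> s \<le> t \<and> \<not> t \<le> s"
    by (cases s; cases t) (simp_all add: less_eq_sign_def less_sign_def)
  show "s \<le> s"
    by (simp add: less_eq_sign_def)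
  show "s \<le> t \<Longrightarrow> t \<le> u \<Longrightarrow> s \<le> u"
    by (cases s; cases t; cases u) (simp_all add: less_eq_sign_def)
  show "s \<le> t \<Longrightarrow> t \<le> s \<Longrightarrow> s = t"
    by (cases s; cases t) (simp_all add: less_eq_sign_def)
  show "s \<le> t \<or> t \<le> s"
    by (cases s; cases t) (simp_all add: less_eq_sign_def)
qed

end

lemma sign_less_chain: "Minus < Zero" "Zero < Plus"
  by (simp_all add: less_sign_def less_eq_sign_def)

definition sign_expansion :: "'o::wellorder set \<Rightarrow> 'o \<Rightarrow> sign" where
  "sign_expansion x \<alpha> =
    (if \<alpha> < birthday x then (if \<alpha> \<in> x then Plus else Minus) else Zero)"

end

theory Submission
  imports Defs
begin

text \<open>
  As soon as \<open>x \<noteq> y\<close>, well-ordering provides a least element \<open>d\<close> of the symmetric difference, so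
  \<open>number_less\<close> compares \<open>x\<close> and \<open>y\<close> by membership at the first place where they differ
  (\<open>number_less_iff\<close>). In this form it is visibly a strict total order.

  The sign-expansion of \<open>x\<close> records membership below the birthday, which is itself the first place
  with the sign \<open>Zero\<close>. Let \<open>x\<close> be the smaller number. If \<open>d\<close> lies below the birthday of \<open>x\<close>, the
  sign sequences first differ at \<open>d\<close>. Otherwise \<open>x\<close> has already ended before \<open>d\<close>, and they first
  differ at the birthday of \<open>x\<close> (\<open>number_less_imp_sign_expansion_less\<close>). The converse is then
  formal: \<open>number_less\<close> is total, the lexicographic order is asymmetric, and an inclusion of a total
  relation in an asymmetric one is an equality.
\<close>

lemma number_less_iff:
  "number_less x y \<longleftrightarrow> (\<exists>d. d \<in> y \<and> d \<notin> x \<and> (\<forall>a<d. a \<in> x \<longleftrightarrow> a \<in> y))"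
proof
  assume less: "number_less x y"
  let ?D = "\<lambda>a. a \<in> (x - y) \<union> (y - x)"
  from less have "\<exists>a. ?D a"
    unfolding number_less_def by blast
  then have "?D (LEAST a. ?D a)"
    by (rule LeastI_ex)
  moreover have "a \<in> x \<longleftrightarrow> a \<in> y" if "a < (LEAST a. ?D a)" for a
    using not_less_Least[OF that] by blast
  ultimately show "\<exists>d. d \<in> y \<and> d \<notin> x \<and> (\<forall>a<d. a \<in> x \<longleftrightarrow> a \<in> y)"
    using less unfolding number_less_def by blast
next
  assume "\<exists>d. d \<in> y \<and> d \<notin> x \<and> (\<forall>a<d. a \<in> x \<longleftrightarrow> a \<in> y)"
  then obtain d where d: "d \<in> y" "d \<notin> x" "\<forall>a<d. a \<in> x \<longleftrightarrow> a \<in> y"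
    by blast
  have "(LEAST a. a \<in> (x - y) \<union> (y - x)) = d"
  proof (rule Least_equality)
    show "d \<in> (x - y) \<union> (y - x)"
      using d by blast
    show "d \<le> a" if "a \<in> (x - y) \<union> (y - x)" for a
      using that d(3) by (meson DiffE UnE not_le_imp_less)
  qed
  with d show "number_less x y"
    unfolding number_less_def by auto
qed

lemma number_less_irrefl: "\<not> number_less x x"
  by (simp add: number_less_def)

lemma number_less_total:
  assumes "x \<noteq> y"
  shows "number_less x y \<or> number_less y x"
proof -
  have "\<exists>a. a \<in> (x - y) \<union> (y - x)"
    using assms by blast
  then have "(LEAST a. a \<in> (x - y) \<union> (y - x)) \<in> (x - y) \<union> (y - x)"
    by (rule LeastI_ex)
  with assms show ?thesis
    unfolding number_less_def by (auto simp: Un_commute)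
qed

text \<open>The first difference between \<open>x\<close> and \<open>z\<close> is at the smaller of the two given ones.\<close>

lemma number_less_trans:
  assumes "number_less x y" "number_less y z"
  shows "number_less x z"
proof -
  obtain d where d: "d \<in> y" "d \<notin> x" "\<forall>a<d. a \<in> x \<longleftrightarrow> a \<in> y"
    using assms(1) unfolding number_less_iff by blast
  obtain e where e: "e \<in> z" "e \<notin> y" "\<forall>a<e. a \<in> y \<longleftrightarrow> a \<in> z"
    using assms(2) unfolding number_less_iff by blast
  have "d \<noteq> e"
    using d e by blast
  then have "min d e \<in> z \<and> min d e \<notin> x"
    using d e by (cases "d < e") (auto simp: min_def)
  moreover have "\<forall>a<min d e. a \<in> x \<longleftrightarrow> a \<in> z"
    using d e by simp
  ultimately show ?thesis
    unfolding number_less_iff by blast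
qed

lemma birthday_greatest:
  assumes "x \<in> numbers"
  shows "birthday x \<in> x" and "a \<in> x \<Longrightarrow> a \<le> birthday x"
proof -
  obtain b where b: "b \<in> x" "\<forall>a\<in>x. a \<le> b"
    using assms unfolding numbers_def is_number_def by blast
  then have "birthday x = b"
    unfolding birthday_def by (intro Greatest_equality) auto
  with b show "birthday x \<in> x" and "a \<in> x \<Longrightarrow> a \<le> birthday x"
    by auto
qed

definition sign_expansion_less :: "'o::wellorder set \<Rightarrow> 'o set \<Rightarrow> bool" where
  "sign_expansion_less x y \<longleftrightarrow>
    (\<exists>\<alpha>. (\<forall>\<beta><\<alpha>. sign_expansion x \<beta> = sign_expansion y \<beta>)
       \<and> sign_expansion x \<alpha> < sign_expansion y \<alpha>)"

lemma sign_expansion_less_asym: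
  assumes "sign_expansion_less x y"
  shows "\<not> sign_expansion_less y x"
  using assms unfolding sign_expansion_less_def
  by (metis less_asym less_irrefl linorder_neqE)

text \<open>
  Let \<open>d\<close> be the first place where \<open>x\<close> and \<open>y\<close> differ. Every \<open>\<beta> < d\<close> lies below the birthday
  of \<open>y\<close>, because \<open>d \<in> y\<close>. Hence the sign sequences can deviate before \<open>d\<close> only through \<open>x\<close>
  having ended.
\<close>

lemma number_less_imp_sign_expansion_less:
  assumes x: "x \<in> numbers" and y: "y \<in> numbers" and less: "number_less x y"
  shows "sign_expansion_less x y"
proof -
  obtain d where d: "d \<in> y" "d \<notin> x" "\<forall>a<d. a \<in> x \<longleftrightarrow> a \<in> y"
    using less unfolding number_less_iff by blast
  have dy: "d \<le> birthday y"
    using birthday_greatest(2)[OF y] d(1) .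
  have agree: "sign_expansion x \<beta> = sign_expansion y \<beta>"
    if "\<beta> < d" "\<beta> < birthday x" for \<beta>
    using that d(3) dy by (simp add: sign_expansion_def)
  have "d \<noteq> birthday x"
    using d(2) birthday_greatest(1)[OF x] by blast
  then consider "d < birthday x" | "birthday x < d"
    by fastforce
  then show ?thesis
  proof cases
    case 1
    \<comment> \<open>If \<open>d\<close> is the birthday of \<open>y\<close>, the sign of \<open>y\<close> at \<open>d\<close> is \<open>Zero\<close>, still above \<open>Minus\<close>.\<close>
    then have "sign_expansion x d < sign_expansion y d"
      using d(1,2) by (simp add: sign_expansion_def less_sign_def less_eq_sign_def)
    with 1 agree show ?thesis
      unfolding sign_expansion_less_def by (meson order.strict_trans)
  next
    case 2
    \<comment> \<open>The birthday of \<open>x\<close> belongs to \<open>x\<close>, hence also to \<open>y\<close>, where it has the sign \<open>Plus\<close>.\<close>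
    then have "birthday x \<in> y"
      using d(3) birthday_greatest(1)[OF x] by blast
    then have "sign_expansion x (birthday x) < sign_expansion y (birthday x)"
      using 2 dy by (simp add: sign_expansion_def sign_less_chain)
    with 2 agree show ?thesis
      unfolding sign_expansion_less_def by (meson order.strict_trans)
  qed
qed

lemma number_less_iff_sign_expansion_less:
  assumes "x \<in> numbers" "y \<in> numbers"
  shows "number_less x y \<longleftrightarrow> sign_expansion_less x y"
  using number_less_imp_sign_expansion_less number_less_total sign_expansion_less_asym assms by metis

theorem theorem2p24:
  shows "irreflp_on (numbers :: 'o::wellorder set set) number_less
    \<and> transp_on (numbers :: 'o set set) number_less
    \<and> totalp_on (numbers :: 'o set set) number_less
    \<and> (\<forall>x \<in> (numbers :: 'o set set). \<forall>y \<in> numbers.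
         number_less x y \<longleftrightarrow>
         (\<exists>\<alpha>. (\<forall>\<beta><\<alpha>. sign_expansion x \<beta> = sign_expansion y \<beta>)
            \<and> sign_expansion x \<alpha> < sign_expansion y \<alpha>))"
proof (intro conjI ballI)
  show "irreflp_on (numbers :: 'o set set) number_less"
    by (simp add: irreflp_on_def number_less_irrefl)
  show "transp_on (numbers :: 'o set set) number_less"
    by (rule transp_onI) (rule number_less_trans)
  show "totalp_on (numbers :: 'o set set) number_less"
    by (rule totalp_onI) (rule number_less_total)
  fix x y :: "'o set"
  assume "x \<in> numbers" "y \<in> numbers"
  then show "number_less x y \<longleftrightarrow>
      (\<exists>\<alpha>. (\<forall>\<beta><\<alpha>. sign_expansion x \<beta> = sign_expansion y \<beta>)
         \<and> sign_expansion x \<alpha> < sign_expansion y \<alpha>)"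
    by (simp only: number_less_iff_sign_expansion_less sign_expansion_less_def)
qed

end
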